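(* Let $X$ be a set. Suppose $\mathcal{M}_1,\mathcal{M}_2$ are matroids with underlying set $X$. Write $\mathrm{Cl}$ for the closure operator in $\mathcal{M}_1$, and write $\mathrm{Int}$ for the interior operator in $\mathcal{M}_2$, i.e., $\mathrm{Int}(U) = c(\mathrm{Cl}_2(cU))$, where $c$ is complementation in $X$, and $\mathrm{Cl}_2$ is the closure operator of $\mathcal{M}_2$. Then the following conditions are equivalent: (i) There exists a strong model structure on the power set $\mathcal{P}(X)$ whose fibrant objects are precisely the closed sets in the matroid $\mathcal{M}_1$, and whose cofibrant objects are precisely the complements of closed sets in the matroid $\mathcal{M}_2$. (ii) There exists a unique strong model structure on the power set $\mathcal{P}(X)$ whose fibrant objects are precisely the closed sets in the matroid $\mathcal{M}_1$, and whose cofibrant objects are precisely the complements of closed sets in the matroid $\mathcal{M}_2$. (iii) The following conditions each hold: $\mathrm{Cl}(\mathrm{Int}(U)) = \mathrm{Int}(\mathrm{Cl}(U))$ for all $U\subseteq X$; if $U\subseteq \mathrm{Int}(V)$ and $\mathrm{Cl}(U)\subseteq V$, then $\mathrm{Cl}(U)\subseteq \mathrm{Int}(V)$ (for all $U,V\subseteq X$); and if $U\subseteq V$ and $\mathrm{Cl}(U)=\mathrm{Cl}(V)$ and $\mathrm{Int}(U)=\mathrm{Int}(V)$, then $U=V$ (for all $U,V\subseteq X$).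
   Context: A Moore collection in $X$ is a collection of subsets of $X$ (called closed sets) closed under arbitrary intersections (including the empty intersection $X$); the closure $\mathrm{Cl}(A)$ of $A\subseteq X$ is the intersection of all closed sets containing $A$. A matroid with underlying set $X$ is a Moore collection on $X$ satisfying: (finitary property) if $x\in \mathrm{Cl}(A)$ for some $x\in X$, $A\subseteq X$, then $x\in \mathrm{Cl}(B)$ for some finite subset $B$ of $A$; (exchange property) if $x,y\in X$, $A\subseteq X$, $x\notin \mathrm{Cl}(A)$ and $x\in \mathrm{Cl}(A\cup\{y\})$, then $y\in \mathrm{Cl}(A\cup\{x\})$. $\mathcal{P}(X)$ is partially ordered by inclusion and regarded as a category with exactly one morphism $U\to V$ if $U\subseteq V$ and none otherwise. A weak factorization system is a pair $(\mathcal{L},\mathcal{R})$ of classes of morphisms such that every morphism factors as a map in $\mathcal{L}$ followed by a map in $\mathcal{R}$, $\mathcal{L}$ is the class of maps with the left lifting property with respect to $\mathcal{R}$, and $\mathcal{R}$ is the class of maps with the right lifting property with respect to $\mathcal{L}$. A model structure is a triple $(\mathrm{cof},\mathrm{we},\mathrm{fib})$ of retract-closed subcategories containing all objects such that $(\mathrm{cof}\cap \mathrm{we},\mathrm{fib})$ and $(\mathrm{cof},\mathrm{we}\cap \mathrm{fib})$ are weak factorization systems and $\mathrm{we}$ has the two-out-of-three property. Acyclic (co)fibrations are (co)fibrations which are weak equivalences. A model structure is strong if: whenever $g\circ f$ is an acyclic cofibration, $f$ is an acyclic cofibration; and whenever $g\circ f$ is an acyclic fibration, $g$ is an acyclic fibration.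 An object $U$ is fibrant if $U\to X$ is a fibration and cofibrant if $\emptyset\to U$ is a cofibration. *)

theory Defs
  imports Main
begin

section \<open>Categories and model structures\<close>

text \<open>\<open>Comp C g f\<close> is the composite \<open>g \<circ> f\<close>, meaningful only when \<open>Cod C f = Dom C g\<close>.\<close>

record ('o, 'm) precategory =
  Obj :: "'o set"
  Arr :: "'m set"
  Dom :: "'m \<Rightarrow> 'o"
  Cod :: "'m \<Rightarrow> 'o"
  Id :: "'o \<Rightarrow> 'm"
  Comp :: "'m \<Rightarrow> 'm \<Rightarrow> 'm"

definition arrow :: "('o, 'm) precategory \<Rightarrow> 'm \<Rightarrow> 'o \<Rightarrow> 'o \<Rightarrow> bool" where
  "arrow C f a b \<longleftrightarrow> f \<in> Arr C \<and> Dom C f = a \<and> Cod C f = b"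

definition composable :: "('o, 'm) precategory \<Rightarrow> 'm \<Rightarrow> 'm \<Rightarrow> bool" where
  "composable C g f \<longleftrightarrow> f \<in> Arr C \<and> g \<in> Arr C \<and> Cod C f = Dom C g"

locale category =
  fixes C :: "('o, 'm) precategory"
  assumes obj: "f \<in> Arr C \<Longrightarrow> Dom C f \<in> Obj C \<and> Cod C f \<in> Obj C"
    and ident: "a \<in> Obj C \<Longrightarrow> arrow C (Id C a) a a"
    and comp: "composable C g f \<Longrightarrow> arrow C (Comp C g f) (Dom C f) (Cod C g)"
    and id_right: "f \<in> Arr C \<Longrightarrow> Comp C f (Id C (Dom C f)) = f"
    and id_left: "f \<in> Arr C \<Longrightarrow> Comp C (Id C (Cod C f)) f = f"
    and assoc: "composable C g f \<Longrightarrow> composable C h g \<Longrightarrow>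
      Comp C (Comp C h g) f = Comp C h (Comp C g f)"

definition has_lifting :: "('o, 'm) precategory \<Rightarrow> 'm \<Rightarrow> 'm \<Rightarrow> bool" where
  "has_lifting C l r \<longleftrightarrow>
     (\<forall>u v. arrow C u (Dom C l) (Dom C r) \<and> arrow C v (Cod C l) (Cod C r) \<and>
            Comp C r u = Comp C v l \<longrightarrow>
        (\<exists>h. arrow C h (Cod C l) (Dom C r) \<and> Comp C h l = u \<and> Comp C r h = v))"

definition left_lifting :: "('o, 'm) precategory \<Rightarrow> 'm set \<Rightarrow> 'm set" where
  "left_lifting C R = {l \<in> Arr C. \<forall>r\<in>R. has_lifting C l r}"

definition right_lifting :: "('o, 'm) precategory \<Rightarrow> 'm set \<Rightarrow> 'm set" where
  "right_lifting C L = {r \<in> Arr C. \<forall>l\<in>L. has_lifting C l r}"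

definition weak_factorization_system ::
    "('o, 'm) precategory \<Rightarrow> 'm set \<Rightarrow> 'm set \<Rightarrow> bool" where
  "weak_factorization_system C L R \<longleftrightarrow>
     L \<subseteq> Arr C \<and> R \<subseteq> Arr C \<and>
     (\<forall>f\<in>Arr C. \<exists>l\<in>L. \<exists>r\<in>R. composable C r l \<and> f = Comp C r l) \<and>
     L = left_lifting C R \<and> R = right_lifting C L"

text \<open>A subcategory containing all objects is given by its class of morphisms.\<close>

definition wide_subcategory :: "('o, 'm) precategory \<Rightarrow> 'm set \<Rightarrow> bool" where
  "wide_subcategory C S \<longleftrightarrow>
     S \<subseteq> Arr C \<and> (\<forall>a\<in>Obj C. Id C a \<in> S) \<and>
     (\<forall>f\<in>S. \<forall>g\<in>S. composable C g f \<longrightarrow> Comp C g f \<in> S)"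

definition retract_of :: "('o, 'm) precategory \<Rightarrow> 'm \<Rightarrow> 'm \<Rightarrow> bool" where
  "retract_of C f g \<longleftrightarrow>
     (\<exists>i p j q.
        arrow C i (Dom C f) (Dom C g) \<and> arrow C p (Dom C g) (Dom C f) \<and>
        arrow C j (Cod C f) (Cod C g) \<and> arrow C q (Cod C g) (Cod C f) \<and>
        Comp C g i = Comp C j f \<and> Comp C f p = Comp C q g \<and>
        Comp C p i = Id C (Dom C f) \<and> Comp C q j = Id C (Cod C f))"

definition retract_closed :: "('o, 'm) precategory \<Rightarrow> 'm set \<Rightarrow> bool" where
  "retract_closed C S \<longleftrightarrow> (\<forall>f\<in>Arr C. \<forall>g\<in>S. retract_of C f g \<longrightarrow> f \<in> S)"

definition two_out_of_three :: "('o, 'm) precategory \<Rightarrow> 'm set \<Rightarrow> bool" where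
  "two_out_of_three C W \<longleftrightarrow>
     (\<forall>f g. composable C g f \<longrightarrow>
        (f \<in> W \<and> g \<in> W \<longrightarrow> Comp C g f \<in> W) \<and>
        (f \<in> W \<and> Comp C g f \<in> W \<longrightarrow> g \<in> W) \<and>
        (g \<in> W \<and> Comp C g f \<in> W \<longrightarrow> f \<in> W))"

record 'm model_triple =
  cof :: "'m set"
  weq :: "'m set"
  fib :: "'m set"

definition model_structure :: "('o, 'm) precategory \<Rightarrow> 'm model_triple \<Rightarrow> bool" where
  "model_structure C M \<longleftrightarrow>
     (\<forall>S\<in>{cof M, weq M, fib M}. wide_subcategory C S \<and> retract_closed C S) \<and>
     weak_factorization_system C (cof M \<inter> weq M) (fib M) \<and>
     weak_factorization_system C (cof M) (weq M \<inter> fib M) \<and>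
     two_out_of_three C (weq M)"

definition strong_model_structure ::
    "('o, 'm) precategory \<Rightarrow> 'm model_triple \<Rightarrow> bool" where
  "strong_model_structure C M \<longleftrightarrow>
     model_structure C M \<and>
     (\<forall>f g. composable C g f \<and> Comp C g f \<in> cof M \<inter> weq M \<longrightarrow> f \<in> cof M \<inter> weq M) \<and>
     (\<forall>f g. composable C g f \<and> Comp C g f \<in> fib M \<inter> weq M \<longrightarrow> g \<in> fib M \<inter> weq M)"


section \<open>The power set as a category\<close>

text \<open>The unique morphism from \<open>U\<close> to \<open>V\<close> is encoded as the pair \<open>(U, V)\<close>.\<close>

definition power_category :: "'a set \<Rightarrow> ('a set, 'a set \<times> 'a set) precategory" where
  "power_category X =
     \<lparr>Obj = Pow X, Arr = {(U, V). U \<subseteq> V \<and> V \<subseteq> X}, Dom = fst, Cod = snd,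
      Id = (\<lambda>U. (U, U)), Comp = (\<lambda>g f. (fst f, snd g))\<rparr>"

lemma category_power_category: "category (power_category X)"
  by unfold_locales
    (simp_all add: power_category_def arrow_def composable_def split_beta, blast+)

definition fibrant_objects ::
    "'a set \<Rightarrow> ('a set \<times> 'a set) model_triple \<Rightarrow> 'a set set" where
  "fibrant_objects X M = {U \<in> Pow X. (U, X) \<in> fib M}"

definition cofibrant_objects ::
    "'a set \<Rightarrow> ('a set \<times> 'a set) model_triple \<Rightarrow> 'a set set" where
  "cofibrant_objects X M = {U \<in> Pow X. ({}, U) \<in> cof M}"


section \<open>Matroids via closed sets\<close>

text \<open>Since \<open>\<Inter>{} = UNIV\<close>, intersecting with \<open>X\<close> makes the empty intersection equal to \<open>X\<close>;
  for nonempty subfamilies it has no effect.\<close>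

definition moore_collection :: "'a set \<Rightarrow> 'a set set \<Rightarrow> bool" where
  "moore_collection X F \<longleftrightarrow> F \<subseteq> Pow X \<and> (\<forall>G\<subseteq>F. X \<inter> \<Inter>G \<in> F)"

definition Cl :: "'a set set \<Rightarrow> 'a set \<Rightarrow> 'a set" where
  "Cl F A = \<Inter>{K \<in> F. A \<subseteq> K}"

definition matroid :: "'a set \<Rightarrow> 'a set set \<Rightarrow> bool" where
  "matroid X F \<longleftrightarrow>
     moore_collection X F \<and>
     (\<forall>x\<in>X. \<forall>A\<subseteq>X. x \<in> Cl F A \<longrightarrow> (\<exists>B\<subseteq>A. finite B \<and> x \<in> Cl F B)) \<and>
     (\<forall>x\<in>X. \<forall>y\<in>X. \<forall>A\<subseteq>X. x \<notin> Cl F A \<and> x \<in> Cl F (A \<union> {y}) \<longrightarrow> y \<in> Cl F (A \<union> {x}))"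

definition interior_op :: "'a set \<Rightarrow> 'a set set \<Rightarrow> 'a set \<Rightarrow> 'a set" where
  "interior_op X F U = X - Cl F (X - U)"

end

theory Submission
  imports Defs
begin

text \<open>In a strong model structure the acyclic cofibrations are the inclusions
  \<open>U \<subseteq> V\<close> with \<open>V \<subseteq> Cl U\<close>, since fibrant replacement of \<open>U\<close> must be \<open>Cl U\<close>;
  dually the acyclic fibrations are those with \<open>Int V \<subseteq> U\<close>. These two classes determine
  everything else, which gives uniqueness, and lifting the former against the latter gives (iii).
  Conversely, each of the resulting pairs is automatically a weak factorization system, and
  the weak equivalences, the inclusions with \<open>Int V \<subseteq> Cl U\<close>, compose because
  \<open>Int (Cl U) \<subseteq> Cl (Int U)\<close>. The one remaining point is that acyclic
  cofibrations are cofibrations: if \<open>V \<subseteq> Cl U\<close> and \<open>v\<close> lies in \<open>V\<close> but neither in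
  \<open>U\<close> nor in \<open>Int V\<close>, then \<open>V - {v}\<close> and \<open>V\<close> have the same closure and the same interior.\<close>

section \<open>Lifting, factorization and retracts in the power set\<close>

lemma power_category_simps:
  "Dom (power_category X) f = fst f"
  "Cod (power_category X) f = snd f"
  "Id (power_category X) U = (U, U)"
  "Comp (power_category X) g f = (fst f, snd g)"
  by (simp_all add: power_category_def)

lemma Arr_power_category: "(U, V) \<in> Arr (power_category X) \<longleftrightarrow> U \<subseteq> V \<and> V \<subseteq> X"
  by (simp add: power_category_def)

lemma arrow_power_category:
  "arrow (power_category X) f U V \<longleftrightarrow> f = (U, V) \<and> U \<subseteq> V \<and> V \<subseteq> X"
  by (cases f) (auto simp: arrow_def power_category_def)

lemma composable_power_category:
  "composable (power_category X) g f \<longleftrightarrow>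
    fst f \<subseteq> snd f \<and> snd f \<subseteq> X \<and> fst g \<subseteq> snd g \<and> snd g \<subseteq> X \<and> snd f = fst g"
  by (auto simp: power_category_def composable_def)

text \<open>Parallel arrows coincide, so every square and both triangles commute automatically, and
  a lift is just an arrow from \<open>B\<close> to \<open>C\<close>. The bounds by \<open>X\<close>
  come from the horizontal arrows of the square, since neither pair is assumed to be an
  arrow.\<close>

lemma has_lifting_power_category:
  "has_lifting (power_category X) (A, B) (C, D) \<longleftrightarrow>
    (A \<subseteq> C \<and> C \<subseteq> X \<and> B \<subseteq> D \<and> D \<subseteq> X \<longrightarrow> B \<subseteq> C)" (is "_ = (?P \<longrightarrow> _)")
proof (intro iffI impI)
  assume l: "has_lifting (power_category X) (A, B) (C, D)" and p: ?P
  have "arrow (power_category X) (A, C) A C" "arrow (power_category X) (B, D) B D"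
    unfolding arrow_power_category using p by simp_all
  then obtain h where "arrow (power_category X) h B C"
    using l[unfolded has_lifting_def, rule_format, of "(A, C)" "(B, D)"]
    unfolding power_category_simps fst_conv snd_conv
    by blast
  then show "B \<subseteq> C" unfolding arrow_power_category by simp
next
  assume r: "?P \<longrightarrow> B \<subseteq> C"
  show "has_lifting (power_category X) (A, B) (C, D)"
    unfolding has_lifting_def
  proof (intro allI impI)
    fix u v
    assume "arrow (power_category X) u (Dom (power_category X) (A, B))
          (Dom (power_category X) (C, D)) \<and>
        arrow (power_category X) v (Cod (power_category X) (A, B))
          (Cod (power_category X) (C, D)) \<and>
        Comp (power_category X) (C, D) u = Comp (power_category X) v (A, B)"
    then have uv: "u = (A, C)" "v = (B, D)" "?P"
      unfolding arrow_power_category power_category_simps fst_conv snd_conv by blast+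
    with r have "B \<subseteq> C" by blast
    with uv show "\<exists>h. arrow (power_category X) h (Cod (power_category X) (A, B))
          (Dom (power_category X) (C, D)) \<and>
        Comp (power_category X) h (A, B) = u \<and> Comp (power_category X) (C, D) h = v"
      by (intro exI[of _ "(B, C)"]) (simp add: arrow_power_category power_category_simps)
  qed
qed

text \<open>For members of \<open>R\<close> the bounds by \<open>X\<close> hold automatically, so
  lifting becomes a condition on inclusions alone.\<close>

lemma left_lifting_power_category:
  assumes "R \<subseteq> Arr (power_category X)"
  shows "(A, B) \<in> left_lifting (power_category X) R \<longleftrightarrow>
    A \<subseteq> B \<and> B \<subseteq> X \<and> (\<forall>(C, D)\<in>R. A \<subseteq> C \<and> B \<subseteq> D \<longrightarrow> B \<subseteq> C)"
proof (cases "A \<subseteq> B \<and> B \<subseteq> X")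
  case True
  have "has_lifting (power_category X) (A, B) r \<longleftrightarrow>
      (case r of (C, D) \<Rightarrow> A \<subseteq> C \<and> B \<subseteq> D \<longrightarrow> B \<subseteq> C)" if "r \<in> R" for r
  proof -
    obtain C D where r: "r = (C, D)" by (cases r)
    have "(C, D) \<in> Arr (power_category X)" using that assms r by blast
    then have CD: "C \<subseteq> D" "D \<subseteq> X" by (simp_all add: Arr_power_category)
    then have "C \<subseteq> X" by (rule order_trans)
    with CD True show ?thesis
      by (simp only: r has_lifting_power_category prod.case simp_thms)
  qed
  then have "(\<forall>r\<in>R. has_lifting (power_category X) (A, B) r) \<longleftrightarrow>
      (\<forall>(C, D)\<in>R. A \<subseteq> C \<and> B \<subseteq> D \<longrightarrow> B \<subseteq> C)"
    by (rule ball_cong[OF refl])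
  with True show ?thesis
    by (simp add: left_lifting_def Arr_power_category)
qed (auto simp: left_lifting_def Arr_power_category)

lemma right_lifting_power_category:
  assumes "L \<subseteq> Arr (power_category X)"
  shows "(C, D) \<in> right_lifting (power_category X) L \<longleftrightarrow>
    C \<subseteq> D \<and> D \<subseteq> X \<and> (\<forall>(A, B)\<in>L. A \<subseteq> C \<and> B \<subseteq> D \<longrightarrow> B \<subseteq> C)"
proof (cases "C \<subseteq> D \<and> D \<subseteq> X")
  case True
  have "has_lifting (power_category X) l (C, D) \<longleftrightarrow>
      (case l of (A, B) \<Rightarrow> A \<subseteq> C \<and> B \<subseteq> D \<longrightarrow> B \<subseteq> C)" if "l \<in> L" for l
  proof -
    obtain A B where l: "l = (A, B)" by (cases l)
    have "C \<subseteq> X" using True by (blast intro: order_trans)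
    with True show ?thesis
      by (simp only: l has_lifting_power_category prod.case simp_thms)
  qed
  then have "(\<forall>l\<in>L. has_lifting (power_category X) l (C, D)) \<longleftrightarrow>
      (\<forall>(A, B)\<in>L. A \<subseteq> C \<and> B \<subseteq> D \<longrightarrow> B \<subseteq> C)"
    by (rule ball_cong[OF refl])
  with True show ?thesis
    by (simp add: right_lifting_def Arr_power_category)
qed (auto simp: right_lifting_def Arr_power_category)

lemma weak_factorization_systemD:
  assumes "weak_factorization_system C L R"
  shows "L \<subseteq> Arr C" "R \<subseteq> Arr C" "left_lifting C R = L" "right_lifting C L = R"
  using assms unfolding weak_factorization_system_def by blast+

text \<open>A factorization of an inclusion is nothing but a choice of intermediate set.\<close>

lemma weak_factorization_system_factor:
  assumes "weak_factorization_system (power_category X) L R" "U \<subseteq> V" "V \<subseteq> X"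
  obtains Z where "(U, Z) \<in> L" "(Z, V) \<in> R" "U \<subseteq> Z" "Z \<subseteq> V"
proof -
  have "(U, V) \<in> Arr (power_category X)"
    using assms by (simp add: Arr_power_category)
  then obtain l r where "l \<in> L" "r \<in> R" "composable (power_category X) r l"
    "(U, V) = Comp (power_category X) r l"
    using assms(1) unfolding weak_factorization_system_def by blast
  then have "(U, snd l) \<in> L" "(snd l, V) \<in> R" "U \<subseteq> snd l" "snd l \<subseteq> V"
    by (cases l, cases r, simp add: composable_power_category power_category_simps)+
  then show thesis by (rule that)
qed

lemma weak_factorization_system_lift:
  assumes "weak_factorization_system (power_category X) L R"
    "(A, B) \<in> L" "(C, D) \<in> R" "A \<subseteq> C" "B \<subseteq> D"
  shows "B \<subseteq> C"
proof -
  have "R \<subseteq> Arr (power_category X)" "(A, B) \<in> left_lifting (power_category X) R"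
    using weak_factorization_systemD[OF assms(1)] assms(2) by blast+
  then show ?thesis
    using assms(3-5) left_lifting_power_category[of R X A B] by fast
qed

text \<open>A retract diagram has arrows in both directions between the domains and between the
  codomains; antisymmetry of inclusion makes the two maps equal.\<close>

lemma retract_closed_power_category:
  assumes "S \<subseteq> Arr (power_category X)"
  shows "retract_closed (power_category X) S"
  unfolding retract_closed_def
proof (intro ballI impI)
  fix f g assume "g \<in> S" and r: "retract_of (power_category X) f g"
  obtain i p j q where
    "arrow (power_category X) i (fst f) (fst g)" "arrow (power_category X) p (fst g) (fst f)"
    "arrow (power_category X) j (snd f) (snd g)" "arrow (power_category X) q (snd g) (snd f)"
    using r unfolding retract_of_def power_category_simps by blast
  then have "fst f = fst g" "snd f = snd g"
    unfolding arrow_power_category by blast+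
  with \<open>g \<in> S\<close> show "f \<in> S" by (metis prod_eqI)
qed

section \<open>Closure and interior for Moore collections\<close>

lemma Cl_superset: "A \<subseteq> Cl F A"
  by (auto simp: Cl_def)

lemma Cl_mono: "A \<subseteq> B \<Longrightarrow> Cl F A \<subseteq> Cl F B"
  by (auto simp: Cl_def)

lemma Cl_least: "K \<in> F \<Longrightarrow> A \<subseteq> K \<Longrightarrow> Cl F A \<subseteq> K"
  by (auto simp: Cl_def)

lemma moore_collection_top: "moore_collection X F \<Longrightarrow> X \<in> F"
  unfolding moore_collection_def by (auto dest: spec[of _ "{}"])

lemma Cl_in_moore_collection:
  assumes "moore_collection X F" "A \<subseteq> X"
  shows "Cl F A \<in> F"
proof -
  \<comment> \<open>The Moore axiom yields the intersection cut down to \<open>X\<close>; the cut is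
    harmless because \<open>X\<close> is itself one of the closed sets above
    \<open>A\<close>.\<close>
  have "X \<inter> Cl F A \<in> F"
    using assms(1) unfolding moore_collection_def Cl_def
    by (elim conjE allE[of _ "{K \<in> F. A \<subseteq> K}"] impE) auto
  moreover have "Cl F A \<subseteq> X"
    by (rule Cl_least[OF moore_collection_top[OF assms(1)] assms(2)])
  ultimately show ?thesis by (simp add: Int_absorb1)
qed

text \<open>\<open>F\<close> holds the prospective fibrant objects; \<open>G\<close> enters through
  complements, which are the prospective cofibrant objects.\<close>

locale moore_pair =
  fixes X :: "'a set" and F G :: "'a set set"
  assumes F: "moore_collection X F" and G: "moore_collection X G"
begin

abbreviation cl :: "'a set \<Rightarrow> 'a set" where "cl \<equiv> Cl F"
abbreviation interior :: "'a set \<Rightarrow> 'a set" where "interior \<equiv> interior_op X G"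

lemma cl_subset: "U \<subseteq> X \<Longrightarrow> cl U \<subseteq> X"
  by (rule Cl_least[OF moore_collection_top[OF F]])

lemma cl_idem: "U \<subseteq> X \<Longrightarrow> cl (cl U) = cl U"
  by (meson Cl_in_moore_collection F Cl_least Cl_superset subset_antisym order_refl)

lemma closed_iff: "U \<subseteq> X \<Longrightarrow> U \<in> F \<longleftrightarrow> cl U \<subseteq> U"
  by (metis Cl_in_moore_collection F Cl_least Cl_superset subset_antisym order_refl)

lemma interior_subset: "interior U \<subseteq> U"
  using Cl_superset[of "X - U" G] by (auto simp: interior_op_def)

lemma interior_mono: "U \<subseteq> V \<Longrightarrow> interior U \<subseteq> interior V"
  using Cl_mono[of "X - V" "X - U" G] by (auto simp: interior_op_def)

lemma open_iff:
  assumes "U \<subseteq> X"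
  shows "U \<in> (\<lambda>K. X - K) ` G \<longleftrightarrow> U \<subseteq> interior U"
proof
  assume "U \<in> (\<lambda>K. X - K) ` G"
  then obtain K where K: "K \<in> G" "U = X - K" by blast
  then have "X - U \<subseteq> K" by auto
  with K show "U \<subseteq> interior U"
    using Cl_least[of K G "X - U"] by (auto simp: interior_op_def)
next
  assume "U \<subseteq> interior U"
  then have "U = X - Cl G (X - U)"
    using interior_subset[of U] by (auto simp: interior_op_def)
  then show "U \<in> (\<lambda>K. X - K) ` G"
    using Cl_in_moore_collection[OF G, of "X - U"] by blast
qed

lemma interior_open: "interior U \<in> (\<lambda>K. X - K) ` G"
  using Cl_in_moore_collection[OF G, of "X - U"] by (auto simp: interior_op_def)

lemma interior_subset_X: "interior U \<subseteq> X"
  by (auto simp: interior_op_def)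

lemma interior_idem: "interior (interior U) = interior U"
  by (intro equalityI interior_subset open_iff[THEN iffD1] interior_subset_X interior_open)

section \<open>The candidate model structure\<close>

text \<open>Defined independently of \<open>canonical_model\<close>: that this class is the
  intersection of cofibrations and weak equivalences is a separate statement, derived later under
  conditions on \<open>F\<close> and \<open>G\<close>.\<close>

definition acyclic_cof :: "('a set \<times> 'a set) set" where
  "acyclic_cof = {(U, V). U \<subseteq> V \<and> V \<subseteq> X \<and> V \<subseteq> cl U}"

definition acyclic_fib :: "('a set \<times> 'a set) set" where
  "acyclic_fib = {(U, V). U \<subseteq> V \<and> V \<subseteq> X \<and> interior V \<subseteq> U}"

text \<open>A fibration says that \<open>U\<close> is relatively closed in \<open>V\<close>; a
  cofibration adds only points of the interior of \<open>V\<close>. The weak equivalences are the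
  composites of an acyclic cofibration with an acyclic fibration, through
  \<open>V \<inter> cl U\<close>.\<close>

definition canonical_model :: "('a set \<times> 'a set) model_triple" where
  "canonical_model =
    \<lparr>cof = {(U, V). U \<subseteq> V \<and> V \<subseteq> X \<and> V \<subseteq> U \<union> interior V},
     weq = {(U, V). U \<subseteq> V \<and> V \<subseteq> X \<and> interior V \<subseteq> cl U},
     fib = {(U, V). U \<subseteq> V \<and> V \<subseteq> X \<and> V \<inter> cl U \<subseteq> U}\<rparr>"

text \<open>The chain is \<open>B \<subseteq> D \<inter> cl A \<subseteq> D \<inter> cl C
  \<subseteq> C\<close>.\<close>

lemma acyclic_cof_lift:
  assumes "(A, B) \<in> acyclic_cof" "(C, D) \<in> fib canonical_model" "A \<subseteq> C" "B \<subseteq> D"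
  shows "B \<subseteq> C"
  using assms Cl_mono[of A C F] by (simp add: acyclic_cof_def canonical_model_def) blast

text \<open>The chain is \<open>B \<subseteq> A \<union> interior B \<subseteq> A \<union> interior
  D \<subseteq> C\<close>.\<close>

lemma acyclic_fib_lift:
  assumes "(A, B) \<in> cof canonical_model" "(C, D) \<in> acyclic_fib" "A \<subseteq> C" "B \<subseteq> D"
  shows "B \<subseteq> C"
  using assms interior_mono[of B D] by (simp add: acyclic_fib_def canonical_model_def) blast

section \<open>Lifting classes and the two weak factorization systems\<close>

text \<open>As in the next three lemmas, one inclusion is the lifting chain above and the other
  follows by testing against a single extremal map.\<close>

lemma right_lifting_acyclic_cof:
  "right_lifting (power_category X) acyclic_cof = fib canonical_model"
proof -
  have "acyclic_cof \<subseteq> Arr (power_category X)"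
    by (auto simp: acyclic_cof_def Arr_power_category)
  note rl = right_lifting_power_category[OF this]
  have "(C, D) \<in> right_lifting (power_category X) acyclic_cof \<longleftrightarrow> (C, D) \<in> fib canonical_model"
    for C D
  proof
    assume "(C, D) \<in> right_lifting (power_category X) acyclic_cof"
    then have *: "C \<subseteq> D \<and> D \<subseteq> X \<and> (\<forall>(A, B)\<in>acyclic_cof. A \<subseteq> C \<and> B \<subseteq> D \<longrightarrow> B \<subseteq> C)"
      by (rule rl[THEN iffD1])
    note CD = *[THEN conjunct1] *[THEN conjunct2, THEN conjunct1]
      and lift = *[THEN conjunct2, THEN conjunct2, rule_format]
    \<comment> \<open>The test map is the largest acyclic cofibration out of \<open>C\<close> that
      stays inside \<open>D\<close>.\<close>
    have "(C, D \<inter> cl C) \<in> acyclic_cof"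
      using CD Cl_superset[of C F] by (auto simp: acyclic_cof_def)
    then have "D \<inter> cl C \<subseteq> C" using lift[of "(C, D \<inter> cl C)"] by simp
    with CD show "(C, D) \<in> fib canonical_model" by (simp add: canonical_model_def)
  next
    assume "(C, D) \<in> fib canonical_model"
    moreover from this have "C \<subseteq> D" "D \<subseteq> X"
      by (simp_all add: canonical_model_def)
    ultimately show "(C, D) \<in> right_lifting (power_category X) acyclic_cof"
      unfolding rl
      by (intro conjI ballI case_prodI2 impI)
        (assumption | elim conjE, hypsubst, rule acyclic_cof_lift, assumption+)+
  qed
  then show ?thesis by auto
qed

lemma left_lifting_acyclic_fib:
  "left_lifting (power_category X) acyclic_fib = cof canonical_model"
proof -
  have "acyclic_fib \<subseteq> Arr (power_category X)"
    by (auto simp: acyclic_fib_def Arr_power_category)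
  note ll = left_lifting_power_category[OF this]
  have "(A, B) \<in> left_lifting (power_category X) acyclic_fib \<longleftrightarrow> (A, B) \<in> cof canonical_model"
    for A B
  proof
    assume "(A, B) \<in> left_lifting (power_category X) acyclic_fib"
    then have *: "A \<subseteq> B \<and> B \<subseteq> X \<and> (\<forall>(C, D)\<in>acyclic_fib. A \<subseteq> C \<and> B \<subseteq> D \<longrightarrow> B \<subseteq> C)"
      by (rule ll[THEN iffD1])
    note AB = *[THEN conjunct1] *[THEN conjunct2, THEN conjunct1]
      and lift = *[THEN conjunct2, THEN conjunct2, rule_format]
    \<comment> \<open>The test map is the acyclic fibration onto \<open>B\<close> with the smallest
      source containing \<open>A\<close>.\<close>
    have "(A \<union> interior B, B) \<in> acyclic_fib"
      using AB interior_subset[of B] by (auto simp: acyclic_fib_def)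
    then have "B \<subseteq> A \<union> interior B" using lift[of "(A \<union> interior B, B)"] by auto
    with AB show "(A, B) \<in> cof canonical_model" by (simp add: canonical_model_def)
  next
    assume "(A, B) \<in> cof canonical_model"
    moreover from this have "A \<subseteq> B" "B \<subseteq> X"
      by (simp_all add: canonical_model_def)
    ultimately show "(A, B) \<in> left_lifting (power_category X) acyclic_fib"
      unfolding ll
      by (intro conjI ballI case_prodI2 impI)
        (assumption | elim conjE, hypsubst, rule acyclic_fib_lift, assumption+)+
  qed
  then show ?thesis by auto
qed

lemma left_lifting_canonical_fib:
  "left_lifting (power_category X) (fib canonical_model) = acyclic_cof"
proof -
  have "fib canonical_model \<subseteq> Arr (power_category X)"
    by (auto simp: canonical_model_def Arr_power_category)
  note ll = left_lifting_power_category[OF this]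
  have "(A, B) \<in> left_lifting (power_category X) (fib canonical_model) \<longleftrightarrow> (A, B) \<in> acyclic_cof"
    for A B
  proof
    assume "(A, B) \<in> left_lifting (power_category X) (fib canonical_model)"
    then have *: "A \<subseteq> B \<and> B \<subseteq> X \<and> (\<forall>(C, D)\<in>fib canonical_model. A \<subseteq> C \<and> B \<subseteq> D \<longrightarrow> B \<subseteq> C)"
      by (rule ll[THEN iffD1])
    note AB = *[THEN conjunct1] *[THEN conjunct2, THEN conjunct1]
      and lift = *[THEN conjunct2, THEN conjunct2, rule_format]
    \<comment> \<open>Testing against the smallest closed set containing \<open>A\<close>, mapped to
      the terminal object \<open>X\<close>.\<close>
    have "(cl A, X) \<in> fib canonical_model"
      using AB cl_subset[of A] cl_idem[of A] by (auto simp: canonical_model_def)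
    then have "B \<subseteq> cl A" using lift[of "(cl A, X)"] AB Cl_superset[of A F] by simp
    with AB show "(A, B) \<in> acyclic_cof" by (simp add: acyclic_cof_def)
  next
    assume "(A, B) \<in> acyclic_cof"
    moreover from this have "A \<subseteq> B" "B \<subseteq> X"
      by (simp_all add: acyclic_cof_def)
    ultimately show "(A, B) \<in> left_lifting (power_category X) (fib canonical_model)"
      unfolding ll
      by (intro conjI ballI case_prodI2 impI)
        (assumption | elim conjE, hypsubst, rule acyclic_cof_lift, assumption+)+
  qed
  then show ?thesis by auto
qed

lemma right_lifting_canonical_cof:
  "right_lifting (power_category X) (cof canonical_model) = acyclic_fib"
proof -
  have "cof canonical_model \<subseteq> Arr (power_category X)"
    by (auto simp: canonical_model_def Arr_power_category)
  note rl = right_lifting_power_category[OF this]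
  have "(C, D) \<in> right_lifting (power_category X) (cof canonical_model) \<longleftrightarrow> (C, D) \<in> acyclic_fib"
    for C D
  proof
    assume "(C, D) \<in> right_lifting (power_category X) (cof canonical_model)"
    then have *: "C \<subseteq> D \<and> D \<subseteq> X \<and> (\<forall>(A, B)\<in>cof canonical_model. A \<subseteq> C \<and> B \<subseteq> D \<longrightarrow> B \<subseteq> C)"
      by (rule rl[THEN iffD1])
    note CD = *[THEN conjunct1] *[THEN conjunct2, THEN conjunct1]
      and lift = *[THEN conjunct2, THEN conjunct2, rule_format]
    \<comment> \<open>Testing against the largest open subset of \<open>D\<close>, as a map from the
      initial object.\<close>
    have "({}, interior D) \<in> cof canonical_model"
      using interior_subset_X[of D] interior_idem[of D] by (auto simp: canonical_model_def)
    then have "interior D \<subseteq> C" using lift[of "({}, interior D)"] interior_subset[of D] by simp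
    with CD show "(C, D) \<in> acyclic_fib" by (simp add: acyclic_fib_def)
  next
    assume "(C, D) \<in> acyclic_fib"
    moreover from this have "C \<subseteq> D" "D \<subseteq> X"
      by (simp_all add: acyclic_fib_def)
    ultimately show "(C, D) \<in> right_lifting (power_category X) (cof canonical_model)"
      unfolding rl
      by (intro conjI ballI case_prodI2 impI)
        (assumption | elim conjE, hypsubst, rule acyclic_fib_lift, assumption+)+
  qed
  then show ?thesis by auto
qed

text \<open>Each class is already known to be the lifting class of the other, so only factorization
  remains; the middle object is the relative closure of \<open>U\<close> in
  \<open>V\<close>.\<close>

lemma weak_factorization_system_acyclic_cof:
  "weak_factorization_system (power_category X) acyclic_cof (fib canonical_model)"
proof -
  have factor: "\<exists>l\<in>acyclic_cof. \<exists>r\<in>fib canonical_model.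
      composable (power_category X) r l \<and> (U, V) = Comp (power_category X) r l"
    if "U \<subseteq> V" "V \<subseteq> X" for U V
  proof (intro bexI conjI)
    show "(U, V \<inter> cl U) \<in> acyclic_cof"
      using that Cl_superset[of U F] by (auto simp: acyclic_cof_def)
    \<comment> \<open>Idempotence of closure is what makes the middle object relatively closed in
      \<open>V\<close>.\<close>
    have "cl (V \<inter> cl U) \<subseteq> cl U"
      using Cl_mono[of "V \<inter> cl U" "cl U" F] cl_idem[of U] that by auto
    then show "(V \<inter> cl U, V) \<in> fib canonical_model"
      using that by (auto simp: canonical_model_def)
  qed (use that Cl_superset[of U F] in
      \<open>auto simp: composable_power_category power_category_simps\<close>)
  have "\<forall>f\<in>Arr (power_category X). \<exists>l\<in>acyclic_cof. \<exists>r\<in>fib canonical_model.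
      composable (power_category X) r l \<and> f = Comp (power_category X) r l"
  proof
    fix f assume "f \<in> Arr (power_category X)"
    then show "\<exists>l\<in>acyclic_cof. \<exists>r\<in>fib canonical_model.
        composable (power_category X) r l \<and> f = Comp (power_category X) r l"
      using factor[of "fst f" "snd f"] Arr_power_category[of "fst f" "snd f" X] by simp
  qed
  moreover have "acyclic_cof \<subseteq> Arr (power_category X)" "fib canonical_model \<subseteq> Arr (power_category X)"
    by (auto simp: acyclic_cof_def canonical_model_def Arr_power_category)
  ultimately show ?thesis
    unfolding weak_factorization_system_def right_lifting_acyclic_cof left_lifting_canonical_fib
    by blast
qed

text \<open>Dual to the preceding factorization: the interior of \<open>V\<close> is adjoined to
  \<open>U\<close>, and idempotence of the interior makes the first map a cofibration.\<close>

lemma weak_factorization_system_acyclic_fib: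
  "weak_factorization_system (power_category X) (cof canonical_model) acyclic_fib"
proof -
  have factor: "\<exists>l\<in>cof canonical_model. \<exists>r\<in>acyclic_fib.
      composable (power_category X) r l \<and> (U, V) = Comp (power_category X) r l"
    if "U \<subseteq> V" "V \<subseteq> X" for U V
  proof (intro bexI conjI)
    show "(U \<union> interior V, V) \<in> acyclic_fib"
      using that interior_subset[of V] by (auto simp: acyclic_fib_def)
    have "interior V \<subseteq> interior (U \<union> interior V)"
      using interior_mono[of "interior V" "U \<union> interior V"] interior_idem[of V] by auto
    then show "(U, U \<union> interior V) \<in> cof canonical_model"
      using that interior_subset[of V] by (auto simp: canonical_model_def)
  qed (use that interior_subset[of V] in
      \<open>auto simp: composable_power_category power_category_simps\<close>)
  have "\<forall>f\<in>Arr (power_category X). \<exists>l\<in>cof canonical_model. \<exists>r\<in>acyclic_fib.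
      composable (power_category X) r l \<and> f = Comp (power_category X) r l"
  proof
    fix f assume "f \<in> Arr (power_category X)"
    then show "\<exists>l\<in>cof canonical_model. \<exists>r\<in>acyclic_fib.
        composable (power_category X) r l \<and> f = Comp (power_category X) r l"
      using factor[of "fst f" "snd f"] Arr_power_category[of "fst f" "snd f" X] by simp
  qed
  moreover have "cof canonical_model \<subseteq> Arr (power_category X)" "acyclic_fib \<subseteq> Arr (power_category X)"
    by (auto simp: acyclic_fib_def canonical_model_def Arr_power_category)
  ultimately show ?thesis
    unfolding weak_factorization_system_def left_lifting_acyclic_fib right_lifting_canonical_cof
    by blast
qed

section \<open>Fibrant and cofibrant objects of the candidate\<close>

lemma fibrant_objects_canonical: "fibrant_objects X canonical_model = F"
proof (rule set_eqI)
  fix U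
  show "U \<in> fibrant_objects X canonical_model \<longleftrightarrow> U \<in> F"
  proof (cases "U \<subseteq> X")
    case True
    then have "X \<inter> cl U = cl U" using cl_subset by blast
    with True show ?thesis
      by (simp add: fibrant_objects_def canonical_model_def closed_iff)
  next
    case False
    then show ?thesis
      using F by (auto simp: fibrant_objects_def moore_collection_def)
  qed
qed

lemma cofibrant_objects_canonical:
  "cofibrant_objects X canonical_model = (\<lambda>K. X - K) ` G"
proof (rule set_eqI)
  fix U
  show "U \<in> cofibrant_objects X canonical_model \<longleftrightarrow> U \<in> (\<lambda>K. X - K) ` G"
  proof (cases "U \<subseteq> X")
    case True
    then show ?thesis
      by (simp add: cofibrant_objects_def canonical_model_def open_iff)
  next
    case False
    then show ?thesis by (auto simp: cofibrant_objects_def)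
  qed
qed

section \<open>Uniqueness of the strong model structure\<close>

definition realizes :: "('a set \<times> 'a set) model_triple \<Rightarrow> bool" where
  "realizes M \<longleftrightarrow> strong_model_structure (power_category X) M \<and>
     fibrant_objects X M = F \<and> cofibrant_objects X M = (\<lambda>K. X - K) ` G"

text \<open>Lifting against fibrant objects bounds the acyclic cofibrations from above; fibrant
  replacement together with strongness produces all the claimed ones.\<close>

lemma realizes_acyclic_cof:
  assumes "realizes M"
  shows "cof M \<inter> weq M = acyclic_cof"
proof -
  have wfs: "weak_factorization_system (power_category X) (cof M \<inter> weq M) (fib M)"
    using assms by (simp add: realizes_def strong_model_structure_def model_structure_def)
  have "fibrant_objects X M = F" using assms by (simp add: realizes_def)
  then have fibrant: "K \<in> F \<longleftrightarrow> K \<subseteq> X \<and> (K, X) \<in> fib M" for K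
    by (auto simp: fibrant_objects_def)
  have "\<forall>f g. composable (power_category X) g f \<and>
      Comp (power_category X) g f \<in> cof M \<inter> weq M \<longrightarrow> f \<in> cof M \<inter> weq M"
    using assms unfolding realizes_def strong_model_structure_def by (elim conjE)
  then have strong: "f \<in> cof M \<inter> weq M"
    if "composable (power_category X) g f" "Comp (power_category X) g f \<in> cof M \<inter> weq M" for f g
    using that by iprover
  have "(U, V) \<in> cof M \<inter> weq M \<longleftrightarrow> (U, V) \<in> acyclic_cof" for U V
  proof
    assume UV: "(U, V) \<in> cof M \<inter> weq M"
    then have "(U, V) \<in> Arr (power_category X)"
      by (rule weak_factorization_systemD(1)[OF wfs, THEN subsetD])
    then have sub: "U \<subseteq> V" "V \<subseteq> X" by (simp_all add: Arr_power_category)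
    then have "U \<subseteq> X" by (rule order_trans)
    \<comment> \<open>The closure of \<open>U\<close> is fibrant, so \<open>V\<close> must lift into
      it.\<close>
    from Cl_in_moore_collection[OF F this] have "(cl U, X) \<in> fib M" by (simp add: fibrant)
    from weak_factorization_system_lift[OF wfs UV this Cl_superset sub(2)] sub
    show "(U, V) \<in> acyclic_cof" by (simp add: acyclic_cof_def)
  next
    assume "(U, V) \<in> acyclic_cof"
    then have sub: "U \<subseteq> V" "V \<subseteq> X" "V \<subseteq> cl U" by (simp_all add: acyclic_cof_def)
    from sub(1,2) have "U \<subseteq> X" by (rule order_trans)
    \<comment> \<open>\<open>Z\<close> is a fibrant replacement of \<open>U\<close>. It is closed,
      hence contains \<open>cl U\<close> and so \<open>V\<close>; strongness then passes from the
      composite through \<open>V\<close> to its first factor.\<close>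
    then obtain Z where Z: "(U, Z) \<in> cof M \<inter> weq M" "(Z, X) \<in> fib M" "U \<subseteq> Z" "Z \<subseteq> X"
      by (rule weak_factorization_system_factor[OF wfs _ order_refl])
    from Z(2,4) have "Z \<in> F" by (simp add: fibrant)
    from sub(3) Cl_least[OF this Z(3)] have "V \<subseteq> Z" by (rule order_trans)
    with Z sub show "(U, V) \<in> cof M \<inter> weq M"
      by (intro strong[of "(V, Z)" "(U, V)"])
        (simp_all add: composable_power_category power_category_simps)
  qed
  then show ?thesis by auto
qed

text \<open>Dual argument: lift the open set \<open>interior V\<close> in one direction, use
  cofibrant replacement and the other half of strongness in the other.\<close>

lemma realizes_acyclic_fib:
  assumes "realizes M"
  shows "weq M \<inter> fib M = acyclic_fib"
proof -
  have wfs: "weak_factorization_system (power_category X) (cof M) (weq M \<inter> fib M)"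
    using assms by (simp add: realizes_def strong_model_structure_def model_structure_def)
  have "cofibrant_objects X M = (\<lambda>K. X - K) ` G" using assms by (simp add: realizes_def)
  then have cofibrant: "K \<in> (\<lambda>K. X - K) ` G \<longleftrightarrow> K \<subseteq> X \<and> ({}, K) \<in> cof M" for K
    unfolding cofibrant_objects_def by (metis (no_types, lifting) Pow_iff mem_Collect_eq)
  have "\<forall>f g. composable (power_category X) g f \<and>
      Comp (power_category X) g f \<in> fib M \<inter> weq M \<longrightarrow> g \<in> fib M \<inter> weq M"
    using assms unfolding realizes_def strong_model_structure_def by (elim conjE)
  then have strong: "g \<in> weq M \<inter> fib M"
    if "composable (power_category X) g f" "Comp (power_category X) g f \<in> weq M \<inter> fib M" for f g
    using that unfolding Int_commute[of "weq M"] by iprover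
  have "(U, V) \<in> weq M \<inter> fib M \<longleftrightarrow> (U, V) \<in> acyclic_fib" for U V
  proof
    assume UV: "(U, V) \<in> weq M \<inter> fib M"
    then have "(U, V) \<in> Arr (power_category X)"
      by (rule weak_factorization_systemD(2)[OF wfs, THEN subsetD])
    then have sub: "U \<subseteq> V" "V \<subseteq> X" by (simp_all add: Arr_power_category)
    from interior_open[of V] have "({}, interior V) \<in> cof M"
      by (rule cofibrant[THEN iffD1, THEN conjunct2])
    from weak_factorization_system_lift[OF wfs this UV empty_subsetI interior_subset] sub
    show "(U, V) \<in> acyclic_fib" by (simp add: acyclic_fib_def)
  next
    assume "(U, V) \<in> acyclic_fib"
    then have sub: "U \<subseteq> V" "V \<subseteq> X" "interior V \<subseteq> U" by (simp_all add: acyclic_fib_def)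
    \<comment> \<open>\<open>Z\<close> is a cofibrant replacement of \<open>V\<close>. Being open,
      it lies in \<open>interior V\<close> and so in \<open>U\<close>, hence its acyclic fibration
      to \<open>V\<close> factors through \<open>U\<close>.\<close>
    obtain Z where Z: "({}, Z) \<in> cof M" "(Z, V) \<in> weq M \<inter> fib M" "Z \<subseteq> V"
      by (rule weak_factorization_system_factor[OF wfs empty_subsetI sub(2)])
    from Z(3) sub(2) have "Z \<subseteq> X" by (rule order_trans)
    with Z(1) have "Z \<subseteq> interior Z" by (simp add: cofibrant open_iff[symmetric])
    also have "\<dots> \<subseteq> interior V" using Z(3) by (rule interior_mono)
    also note sub(3)
    finally have "Z \<subseteq> U" .
    with Z sub show "(U, V) \<in> weq M \<inter> fib M"
      by (intro strong[of "(U, V)" "(Z, U)"])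
        (simp_all add: composable_power_category power_category_simps)
  qed
  then show ?thesis by auto
qed

text \<open>Once both acyclic classes are known, fibrations and cofibrations are their lifting
  classes, and factorization with two-out-of-three recovers the weak equivalences.\<close>

lemma realizes_imp_canonical:
  assumes "realizes M"
  shows "M = canonical_model"
proof -
  note acyclic = realizes_acyclic_cof[OF assms] realizes_acyclic_fib[OF assms]
  have ms: "model_structure (power_category X) M"
    using assms by (simp add: realizes_def strong_model_structure_def)
  then have wfs: "weak_factorization_system (power_category X) acyclic_cof (fib M)"
      "weak_factorization_system (power_category X) (cof M) acyclic_fib"
    by (simp_all add: model_structure_def acyclic)
  have W: "two_out_of_three (power_category X) (weq M)"
    and arr: "weq M \<subseteq> Arr (power_category X)"
    using ms by (simp_all add: model_structure_def wide_subcategory_def)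
  have f: "fib M = fib canonical_model"
    using weak_factorization_systemD(4)[OF wfs(1)] right_lifting_acyclic_cof by simp
  have c: "cof M = cof canonical_model"
    using weak_factorization_systemD(3)[OF wfs(2)] left_lifting_acyclic_fib by simp
  have comp: "((U, Z) \<in> weq M \<and> (Z, V) \<in> weq M \<longrightarrow> (U, V) \<in> weq M) \<and>
      ((U, Z) \<in> weq M \<and> (U, V) \<in> weq M \<longrightarrow> (Z, V) \<in> weq M)"
    if "U \<subseteq> Z" "Z \<subseteq> V" "V \<subseteq> X" for U Z V
  proof -
    from that(2,3) have "Z \<subseteq> X" by (rule order_trans)
    with that have "composable (power_category X) (Z, V) (U, Z)"
      by (simp add: composable_power_category)
    from W[unfolded two_out_of_three_def power_category_simps,
        THEN spec, of "(U, Z)", THEN spec, of "(Z, V)", THEN mp, OF this]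
    show ?thesis unfolding fst_conv snd_conv by iprover
  qed
  have "(U, V) \<in> weq M \<longleftrightarrow> (U, V) \<in> weq canonical_model" for U V
  proof
    assume UV: "(U, V) \<in> weq M"
    then have "(U, V) \<in> Arr (power_category X)" by (rule subsetD[OF arr])
    then have sub: "U \<subseteq> V" "V \<subseteq> X" by (simp_all add: Arr_power_category)
    \<comment> \<open>Cancelling the acyclic cofibration from the weak equivalence leaves a
      fibration that is itself a weak equivalence.\<close>
    obtain Z where Z: "(U, Z) \<in> acyclic_cof" "(Z, V) \<in> fib M" "U \<subseteq> Z" "Z \<subseteq> V"
      by (rule weak_factorization_system_factor[OF wfs(1) sub])
    from Z(1) have "(U, Z) \<in> weq M" by (simp add: acyclic(1)[symmetric])
    with UV comp[OF Z(3,4) sub(2)] have "(Z, V) \<in> weq M" by iprover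
    with Z(2) have "(Z, V) \<in> acyclic_fib" by (simp add: acyclic(2)[symmetric])
    then have "interior V \<subseteq> Z" by (simp add: acyclic_fib_def)
    also have "\<dots> \<subseteq> cl U" using Z(1) by (simp add: acyclic_cof_def)
    finally show "(U, V) \<in> weq canonical_model"
      using sub by (simp add: canonical_model_def)
  next
    assume "(U, V) \<in> weq canonical_model"
    then have sub: "U \<subseteq> V" "V \<subseteq> X" "interior V \<subseteq> cl U"
      by (simp_all add: canonical_model_def)
    have Z: "U \<subseteq> V \<inter> cl U" "V \<inter> cl U \<subseteq> X"
      using sub(1,2) Cl_superset[of U F] by blast+
    have "(U, V \<inter> cl U) \<in> acyclic_cof"
      unfolding acyclic_cof_def using Z by simp
    moreover have "(V \<inter> cl U, V) \<in> acyclic_fib"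
      unfolding acyclic_fib_def using sub interior_subset[of V] by simp
    ultimately have "(U, V \<inter> cl U) \<in> weq M" "(V \<inter> cl U, V) \<in> weq M"
      by (simp_all add: acyclic[symmetric])
    with comp[OF Z(1) Int_lower1 sub(2)] show "(U, V) \<in> weq M" by iprover
  qed
  then have "weq M = weq canonical_model" by auto
  with f c show ?thesis by simp
qed

section \<open>Necessity of the closure and interior conditions\<close>

lemma realizes_imp_conditions:
  assumes "realizes M"
  shows "\<And>U V. U \<subseteq> X \<Longrightarrow> V \<subseteq> X \<Longrightarrow> U \<subseteq> interior V \<Longrightarrow> cl U \<subseteq> V \<Longrightarrow> cl U \<subseteq> interior V"
    and "\<And>U. U \<subseteq> X \<Longrightarrow> cl (interior U) = interior (cl U)"
    and "\<And>U V. U \<subseteq> V \<Longrightarrow> V \<subseteq> X \<Longrightarrow> cl U = cl V \<Longrightarrow> interior U = interior V \<Longrightarrow> U = V"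
proof -
  have M: "M = canonical_model" by (rule realizes_imp_canonical[OF assms])
  have ms: "model_structure (power_category X) M"
    using assms by (simp add: realizes_def strong_model_structure_def)
  then have W: "two_out_of_three (power_category X) (weq canonical_model)"
    by (simp add: M model_structure_def)
  have wfs: "weak_factorization_system (power_category X) acyclic_cof (fib M)"
    using ms by (simp add: model_structure_def realizes_acyclic_cof[OF assms, symmetric])
  \<comment> \<open>Acyclic fibrations are fibrations in \<open>M\<close>, so acyclic cofibrations
    lift against them; this compatibility links \<open>F\<close> with \<open>G\<close>.\<close>
  have orth: "B \<subseteq> C" if "(A, B) \<in> acyclic_cof" "(C, D) \<in> acyclic_fib" "A \<subseteq> C" "B \<subseteq> D" for A B C D
  proof (rule weak_factorization_system_lift[OF wfs that(1) _ that(3,4)])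
    show "(C, D) \<in> fib M" using that(2) by (simp add: realizes_acyclic_fib[OF assms, symmetric])
  qed
  show lift: "cl U \<subseteq> interior V" if "U \<subseteq> X" "V \<subseteq> X" "U \<subseteq> interior V" "cl U \<subseteq> V" for U V
  proof (rule orth)
    show "(U, cl U) \<in> acyclic_cof"
      using cl_subset[OF that(1)] by (simp add: acyclic_cof_def Cl_superset)
    show "(interior V, V) \<in> acyclic_fib"
      using that(2) by (simp add: acyclic_fib_def interior_subset)
  qed (rule that)+
  \<comment> \<open>The inclusion is both an acyclic cofibration and an acyclic fibration; lifting
    it against itself gives an inverse.\<close>
  show "U = V" if "U \<subseteq> V" "V \<subseteq> X" "cl U = cl V" "interior U = interior V" for U V
  proof (rule equalityI[OF that(1) orth])
    show "(U, V) \<in> acyclic_cof"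
      unfolding acyclic_cof_def using that Cl_superset[of V F] by simp
    show "(U, V) \<in> acyclic_fib"
      unfolding acyclic_fib_def using that interior_subset[of U] by simp
  qed simp_all
  show "cl (interior U) = interior (cl U)" if U: "U \<subseteq> X" for U
  proof
    show "cl (interior U) \<subseteq> interior (cl U)"
      \<comment> \<open>This is \<open>lift\<close> applied to \<open>interior U\<close> and
        \<open>cl U\<close>.\<close>
      by (intro lift interior_subset_X cl_subset U interior_mono Cl_superset Cl_mono interior_subset)
    have "interior (cl U) \<subseteq> cl U" by (rule interior_subset)
    \<comment> \<open>That the composite of these two weak equivalences is a weak equivalence is
      exactly the remaining inclusion.\<close>
    then have "(interior U, U) \<in> weq canonical_model" "(U, cl U) \<in> weq canonical_model"
      using U cl_subset[OF U] by (simp_all add: canonical_model_def Cl_superset interior_subset)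
    moreover have "composable (power_category X) (U, cl U) (interior U, U)"
      using U cl_subset[OF U] by (simp add: composable_power_category Cl_superset interior_subset)
    from W[unfolded two_out_of_three_def power_category_simps,
        THEN spec, of "(interior U, U)", THEN spec, of "(U, cl U)", THEN mp, OF this]
    have "(interior U, U) \<in> weq canonical_model \<and> (U, cl U) \<in> weq canonical_model \<longrightarrow>
        (interior U, cl U) \<in> weq canonical_model"
      unfolding fst_conv snd_conv by (rule conjunct1)
    ultimately have "(interior U, cl U) \<in> weq canonical_model" by iprover
    then show "interior (cl U) \<subseteq> cl (interior U)" by (simp add: canonical_model_def)
  qed
qed

section \<open>Sufficiency: the candidate is a strong model structure\<close>

text \<open>The first hypothesis makes weak equivalences compose; separation makes acyclic
  cofibrations cofibrations and acyclic fibrations fibrations.\<close>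

lemma canonical_model_realizes:
  assumes interior_cl: "\<And>U. U \<subseteq> X \<Longrightarrow> interior (cl U) \<subseteq> cl (interior U)"
    and separated: "\<And>U V. U \<subseteq> V \<Longrightarrow> V \<subseteq> X \<Longrightarrow> cl U = cl V \<Longrightarrow> interior U = interior V \<Longrightarrow> U = V"
  shows "realizes canonical_model"
proof -
  \<comment> \<open>Deleting one uncovered point keeps a set between \<open>U\<close> and
    \<open>V\<close>, so the closure is unchanged, and keeps \<open>interior V\<close> inside, so
    the interior is unchanged.\<close>
  have cover: "V \<subseteq> U \<union> interior V" if sub: "U \<subseteq> V" "V \<subseteq> X" "V \<subseteq> cl U" for U V
  proof (rule ccontr)
    assume "\<not> V \<subseteq> U \<union> interior V"
    then obtain v where v: "v \<in> V" "v \<notin> U" "v \<notin> interior V" by blast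
    have "U \<subseteq> V - {v}" using sub(1) v(2) by blast
    then have "cl U \<subseteq> cl (V - {v})" by (rule Cl_mono)
    moreover have "cl V \<subseteq> cl U"
      using Cl_mono[OF sub(3), of F] cl_idem[OF order_trans[OF sub(1,2)]] by simp
    ultimately have "cl V \<subseteq> cl (V - {v})" by (rule order_trans[rotated])
    then have "cl (V - {v}) = cl V" by (rule equalityI[OF Cl_mono[OF Diff_subset]])
    moreover have "interior V \<subseteq> V - {v}" using interior_subset[of V] v by blast
    then have "interior (V - {v}) = interior V"
      using interior_mono[of "interior V" "V - {v}"] interior_idem[of V]
      by (intro equalityI[OF interior_mono[OF Diff_subset]]) simp
    ultimately have "V - {v} = V" by (rule separated[OF Diff_subset sub(2)])
    with v(1) show False by blast
  qed
  have "(U, V) \<in> cof canonical_model \<inter> weq canonical_model \<longleftrightarrow> (U, V) \<in> acyclic_cof" for U V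
  proof
    assume "(U, V) \<in> acyclic_cof"
    then have sub: "U \<subseteq> V" "V \<subseteq> X" "V \<subseteq> cl U" by (simp_all add: acyclic_cof_def)
    from interior_subset sub(3) have "interior V \<subseteq> cl U" by (rule order_trans)
    with sub cover[OF sub] show "(U, V) \<in> cof canonical_model \<inter> weq canonical_model"
      by (simp add: canonical_model_def)
  next
    assume "(U, V) \<in> cof canonical_model \<inter> weq canonical_model"
    then have sub: "U \<subseteq> V" "V \<subseteq> X" "V \<subseteq> U \<union> interior V" "interior V \<subseteq> cl U"
      by (simp_all add: canonical_model_def)
    have "V \<subseteq> cl U" using sub(3,4) Cl_superset[of U F] by blast
    with sub show "(U, V) \<in> acyclic_cof" by (simp add: acyclic_cof_def)
  qed
  then have AC: "cof canonical_model \<inter> weq canonical_model = acyclic_cof" by auto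
  have "(U, V) \<in> weq canonical_model \<inter> fib canonical_model \<longleftrightarrow> (U, V) \<in> acyclic_fib" for U V
  proof
    assume "(U, V) \<in> acyclic_fib"
    then have sub: "U \<subseteq> V" "V \<subseteq> X" "interior V \<subseteq> U" by (simp_all add: acyclic_fib_def)
    from sub(3) Cl_superset have le: "interior V \<subseteq> cl U" by (rule order_trans)
    \<comment> \<open>The inclusion of \<open>U\<close> into its relative closure in
      \<open>V\<close> is an acyclic cofibration, so \<open>cover\<close> applies; the interior it
      adds lies in \<open>interior V\<close>, which is already in \<open>U\<close>.\<close>
    have "V \<inter> cl U \<subseteq> U \<union> interior (V \<inter> cl U)"
    proof (rule cover)
      show "U \<subseteq> V \<inter> cl U" using sub(1) Cl_superset[of U F] by (rule Int_greatest)
      show "V \<inter> cl U \<subseteq> X" using sub(2) by (rule le_infI1)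
      show "V \<inter> cl U \<subseteq> cl U" by (rule Int_lower2)
    qed
    also have "\<dots> \<subseteq> U"
      using order_trans[OF interior_mono[OF Int_lower1] sub(3)] by (intro Un_least order_refl)
    finally show "(U, V) \<in> weq canonical_model \<inter> fib canonical_model"
      using sub(1,2) le by (simp add: canonical_model_def)
  next
    assume "(U, V) \<in> weq canonical_model \<inter> fib canonical_model"
    then have sub: "U \<subseteq> V" "V \<subseteq> X" "V \<inter> cl U \<subseteq> U" "interior V \<subseteq> cl U"
      by (simp_all add: canonical_model_def)
    have "interior V \<subseteq> U" using sub(3,4) interior_subset[of V] by blast
    with sub show "(U, V) \<in> acyclic_fib" by (simp add: acyclic_fib_def)
  qed
  then have AF: "weq canonical_model \<inter> fib canonical_model = acyclic_fib" by auto
  have arr: "S \<subseteq> Arr (power_category X)"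
    if "S \<in> {cof canonical_model, weq canonical_model, fib canonical_model}" for S
    using that by (auto simp: canonical_model_def Arr_power_category)
  have comp_weq: "interior Z \<subseteq> cl U"
    if "U \<subseteq> X" "V \<subseteq> X" "interior V \<subseteq> cl U" "interior Z \<subseteq> cl V" for U V Z
  proof -
    have "interior Z \<subseteq> interior (cl V)"
      using interior_mono[OF that(4)] by (simp add: interior_idem)
    also have "\<dots> \<subseteq> cl (interior V)" using that(2) by (rule interior_cl)
    also have "\<dots> \<subseteq> cl U"
      using Cl_mono[OF that(3), of F] by (simp add: cl_idem[OF that(1)])
    finally show ?thesis .
  qed
  have wide: "wide_subcategory (power_category X) S"
    if S: "S \<in> {cof canonical_model, weq canonical_model, fib canonical_model}" for S
  proof -
    have refl: "(U, U) \<in> S" if "U \<subseteq> X" for U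
    proof -
      have "interior U \<subseteq> cl U" using interior_subset Cl_superset by (rule order_trans)
      then show ?thesis using S that by (elim insertE emptyE) (simp_all add: canonical_model_def)
    qed
    have trans: "(U, Z) \<in> S" if UV: "(U, V) \<in> S" and VZ: "(V, Z) \<in> S" for U V Z
    proof -
      have "U \<subseteq> V" "V \<subseteq> Z" "Z \<subseteq> X"
        using subsetD[OF arr[OF S] UV] subsetD[OF arr[OF S] VZ] by (simp_all add: Arr_power_category)
      note sub = this order_trans[OF this(1,2)] order_trans[OF this(2,3)]
      have "U \<subseteq> X" using sub(1,5) by (rule order_trans)
      from S show ?thesis
      proof (elim insertE emptyE)
        assume S: "S = cof canonical_model"
        have "V \<subseteq> U \<union> interior V" "Z \<subseteq> V \<union> interior Z"
          using UV VZ by (simp_all add: S canonical_model_def)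
        with interior_mono[OF sub(2)] have "Z \<subseteq> U \<union> interior Z" by blast
        with sub show ?thesis by (simp add: S canonical_model_def)
      next
        assume S: "S = weq canonical_model"
        have "interior V \<subseteq> cl U" "interior Z \<subseteq> cl V"
          using UV VZ by (simp_all add: S canonical_model_def)
        from comp_weq[OF \<open>U \<subseteq> X\<close> sub(5) this] sub
        show ?thesis by (simp add: S canonical_model_def)
      next
        assume S: "S = fib canonical_model"
        have "V \<inter> cl U \<subseteq> U" "Z \<inter> cl V \<subseteq> V"
          using UV VZ by (simp_all add: S canonical_model_def)
        \<comment> \<open>A point of \<open>Z\<close> in \<open>cl U\<close> is also in
          \<open>cl V\<close>, hence in \<open>V\<close> by the second fibration and then in
          \<open>U\<close> by the first.\<close>
        with Cl_mono[OF sub(1), of F] have "Z \<inter> cl U \<subseteq> U" by blast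
        with sub show ?thesis by (simp add: S canonical_model_def)
      qed
    qed
    show ?thesis
      unfolding wide_subcategory_def power_category_simps
    proof (intro conjI ballI impI arr[OF S])
      fix U assume "U \<in> Obj (power_category X)"
      then show "(U, U) \<in> S" by (intro refl) (simp add: power_category_def)
    next
      fix f g assume "f \<in> S" "g \<in> S" "composable (power_category X) g f"
      then have "(fst f, snd f) \<in> S" "(fst g, snd g) \<in> S" "snd f = fst g"
        unfolding prod.collapse by (simp_all add: composable_def power_category_simps)
      then show "(fst f, snd g) \<in> S" by (metis trans)
    qed
  qed
  have "two_out_of_three (power_category X) (weq canonical_model)"
    unfolding two_out_of_three_def power_category_simps
  proof (intro allI impI)
    fix f g
    assume c: "composable (power_category X) g f"
    then have g: "fst g = snd f" by (simp add: composable_power_category)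
    have sub: "fst f \<subseteq> snd f" "snd f \<subseteq> snd g" "snd g \<subseteq> X"
      using c unfolding composable_power_category g by simp_all
    obtain U V Z where fg: "f = (U, V)" "g = (V, Z)"
      using g by (metis prod.collapse)
    have UVZ: "U \<subseteq> V" "V \<subseteq> Z" "Z \<subseteq> X" using sub by (simp_all add: fg)
    then have X: "U \<subseteq> Z" "V \<subseteq> X" "U \<subseteq> X" by (blast intro: order_trans)+
    have mem: "(A, B) \<in> weq canonical_model \<longleftrightarrow> interior B \<subseteq> cl A" if "A \<subseteq> B" "B \<subseteq> X" for A B
      using that by (simp add: canonical_model_def)
    \<comment> \<open>Composition is \<open>comp_weq\<close>. For cancellation, monotonicity alone
      shows that both factors of a weak equivalence are weak equivalences.\<close>
    note comp_weq[OF X(3,2), of Z]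
    moreover have "interior Z \<subseteq> cl U \<Longrightarrow> interior Z \<subseteq> cl V"
      using Cl_mono[OF UVZ(1)] by (rule order_trans[rotated])
    moreover have "interior Z \<subseteq> cl U \<Longrightarrow> interior V \<subseteq> cl U"
      using interior_mono[OF UVZ(2)] by (rule order_trans)
    ultimately show "(f \<in> weq canonical_model \<and> g \<in> weq canonical_model \<longrightarrow>
          (fst f, snd g) \<in> weq canonical_model) \<and>
        (f \<in> weq canonical_model \<and> (fst f, snd g) \<in> weq canonical_model \<longrightarrow>
          g \<in> weq canonical_model) \<and>
        (g \<in> weq canonical_model \<and> (fst f, snd g) \<in> weq canonical_model \<longrightarrow>
          f \<in> weq canonical_model)"
      unfolding fg fst_conv snd_conv mem[OF UVZ(1) X(2)] mem[OF UVZ(2,3)] mem[OF X(1) UVZ(3)]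
      by iprover
  qed
  then have ms: "model_structure (power_category X) canonical_model"
    unfolding model_structure_def AC AF
    by (intro conjI ballI wide retract_closed_power_category[OF arr]
        weak_factorization_system_acyclic_cof weak_factorization_system_acyclic_fib)
  \<comment> \<open>Strongness is transitivity of inclusion: the middle set lies in the target of
    the composite, and so in the closure of its source. The dual half squeezes the interior of the
    target through the source.\<close>
  have "f \<in> acyclic_cof"
    if "composable (power_category X) g f \<and> Comp (power_category X) g f \<in> acyclic_cof" for f g
  proof -
    obtain U V where f: "f = (U, V)" by (cases f)
    from that have sub: "U \<subseteq> V" "V \<subseteq> X" "V \<subseteq> snd g" "snd g \<subseteq> cl U"
      unfolding f composable_power_category power_category_simps acyclic_cof_def
      by (elim conjE, simp)+
    from sub(3,4) have "V \<subseteq> cl U" by (rule order_trans)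
    with sub(1,2) show ?thesis by (simp add: f acyclic_cof_def)
  qed
  moreover have "g \<in> acyclic_fib"
    if "composable (power_category X) g f \<and> Comp (power_category X) g f \<in> acyclic_fib" for f g
  proof -
    obtain V Z where g: "g = (V, Z)" by (cases g)
    from that have sub: "V \<subseteq> Z" "Z \<subseteq> X" "interior Z \<subseteq> fst f" "fst f \<subseteq> V"
      unfolding g composable_power_category power_category_simps acyclic_fib_def
      by (elim conjE, simp)+
    from sub(3,4) have "interior Z \<subseteq> V" by (rule order_trans)
    with sub(1,2) show ?thesis by (simp add: g acyclic_fib_def)
  qed
  ultimately show ?thesis
    unfolding realizes_def strong_model_structure_def AC
      Int_commute[of "fib canonical_model"] AF
    by (intro conjI allI impI ms fibrant_objects_canonical cofibrant_objects_canonical)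
qed

end

section \<open>Equivalence of existence, uniqueness and the conditions\<close>

theorem proposition4p7:
  fixes X :: "'a set" and M1 M2 :: "'a set set"
  assumes "matroid X M1" and "matroid X M2"
  shows
    "((\<exists>M. strong_model_structure (power_category X) M \<and>
           fibrant_objects X M = M1 \<and>
           cofibrant_objects X M = (\<lambda>K. X - K) ` M2)
      \<longleftrightarrow>
      (\<exists>!M. strong_model_structure (power_category X) M \<and>
           fibrant_objects X M = M1 \<and>
           cofibrant_objects X M = (\<lambda>K. X - K) ` M2))
     \<and>
     ((\<exists>M. strong_model_structure (power_category X) M \<and>
           fibrant_objects X M = M1 \<and>
           cofibrant_objects X M = (\<lambda>K. X - K) ` M2)
      \<longleftrightarrow>
      (\<forall>U\<subseteq>X. Cl M1 (interior_op X M2 U) = interior_op X M2 (Cl M1 U)) \<and>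
      (\<forall>U\<subseteq>X. \<forall>V\<subseteq>X. U \<subseteq> interior_op X M2 V \<and> Cl M1 U \<subseteq> V \<longrightarrow>
           Cl M1 U \<subseteq> interior_op X M2 V) \<and>
      (\<forall>U\<subseteq>X. \<forall>V\<subseteq>X. U \<subseteq> V \<and> Cl M1 U = Cl M1 V \<and>
           interior_op X M2 U = interior_op X M2 V \<longrightarrow> U = V))"
proof -
  interpret moore_pair X M1 M2
    using assms by unfold_locales (simp_all add: matroid_def)
  \<comment> \<open>Any realizing structure equals \<open>canonical_model\<close>, so existence
    already forces uniqueness.\<close>
  have "(\<exists>M. realizes M) \<longleftrightarrow> (\<exists>!M. realizes M)"
    using realizes_imp_canonical by metis
  moreover have "(\<exists>M. realizes M) \<longleftrightarrow>
      (\<forall>U\<subseteq>X. cl (interior U) = interior (cl U)) \<and>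
      (\<forall>U\<subseteq>X. \<forall>V\<subseteq>X. U \<subseteq> interior V \<and> cl U \<subseteq> V \<longrightarrow> cl U \<subseteq> interior V) \<and>
      (\<forall>U\<subseteq>X. \<forall>V\<subseteq>X. U \<subseteq> V \<and> cl U = cl V \<and> interior U = interior V \<longrightarrow> U = V)"
    (is "_ \<longleftrightarrow> ?conditions")
  proof
    assume "\<exists>M. realizes M"
    then obtain M where "realizes M" by blast
    note realized = realizes_imp_conditions[OF this]
    show ?conditions
      by (intro conjI allI impI; (elim conjE)?; (rule realized; assumption))
  next
    assume c: ?conditions
    have "realizes canonical_model"
    proof (rule canonical_model_realizes)
      show "interior (cl U) \<subseteq> cl (interior U)" if "U \<subseteq> X" for U
        using c[THEN conjunct1, rule_format, OF that] by simp
      show "U = V" if "U \<subseteq> V" "V \<subseteq> X" "cl U = cl V" "interior U = interior V" for U V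
        using c[THEN conjunct2, THEN conjunct2, rule_format, OF order_trans[OF that(1,2)] that(2)]
          that by iprover
    qed
    then show "\<exists>M. realizes M" by blast
  qed
  ultimately show ?thesis
    unfolding realizes_def by (rule conjI)
qed

end
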